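(* Let $\mathcal{G}=(S,i_0,F,A,T_{\mathrm{cop}},T_{\mathrm{rob}})$ be a GPCR game and $w_n$ the recursion defined in the context. Then the pointwise limit $w_\infty=\lim_{n\to\infty}w_n$ exists and satisfies, for all $s\in S$: $w_\infty(s)=1$ if $s\in F$, and otherwise $$w_\infty(s)=\max_{a\in A_{\mathrm{cop}}(s)}\sum_{s'\in S}T_{\mathrm{cop}}(s,a,s')\min_{a'\in A_{\mathrm{rob}}(s')}\sum_{s''\in S}T_{\mathrm{rob}}(s',a',s'')\,w_\infty(s'').$$ Moreover, the optimal memoryless strategy for the cops in $\mathcal{G}$, from any state $s$, can be retrieved by a cops' action at which the maximum in this equation is achieved.
   Context: A GPCR game: $S$ non-empty finite set of states, $i_0\in S$ initial state, $F\subseteq S$ final states, $A=A_{\mathrm{cop}}\cup A_{\mathrm{rob}}$ non-empty finite action sets; $T_{\mathrm{cop}}:S\times A_{\mathrm{cop}}\times S\to[0,1]$ with $\sum_{s'}T_{\mathrm{cop}}(s,a,s')\in\{0,1\}$, $A_{\mathrm{cop}}(s)$ (non-empty) the set of playable actions (sum $=1$), and $T_{\mathrm{cop}}(s,a,s)=1$ for $s\in F$; $T_{\mathrm{rob}}$, $A_{\mathrm{rob}}(s)$ analogous. Plays alternate cop moves and robber moves (next state drawn from the transition function of the chosen playable action), starting with the cops at $i_0$; the cops win iff a state of $F$ is reached. A memoryless strategy is a map $S\to A$. The recursion: $w_0(s)=1$ if $s\in F$, $0$ otherwise; for $n\ge1$, $w_n(s)=1$ if $s\in F$, else $w_n(s)=\max_{a\in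 A_{\mathrm{cop}}(s)}\sum_{s'}T_{\mathrm{cop}}(s,a,s')\min_{a'\in A_{\mathrm{rob}}(s')}\sum_{s''}T_{\mathrm{rob}}(s',a',s'')w_{n-1}(s'')$.
   Formalization: The last sentence is proved as: some memoryless strategy choosing a maximizing action at every non-final state is optimal from all states; not every choice of maximizing actions is optimal, since e.g. staying put forever may also attain the maximum. *)

theory Defs
  imports "HOL-Probability.Probability"
begin

record ('s, 'a) gpcr =
  states :: "'s set"
  init :: 's
  final :: "'s set"
  cop_actions :: "'a set"
  rob_actions :: "'a set"
  cop_trans :: "'s \<Rightarrow> 'a \<Rightarrow> 's \<Rightarrow> real"
  rob_trans :: "'s \<Rightarrow> 'a \<Rightarrow> 's \<Rightarrow> real"

definition actions :: "('s, 'a) gpcr \<Rightarrow> 'a set" where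
  "actions G = cop_actions G \<union> rob_actions G"

definition cop_playable :: "('s, 'a) gpcr \<Rightarrow> 's \<Rightarrow> 'a set" where
  "cop_playable G s = {a \<in> cop_actions G. (\<Sum>t\<in>states G. cop_trans G s a t) = 1}"

definition rob_playable :: "('s, 'a) gpcr \<Rightarrow> 's \<Rightarrow> 'a set" where
  "rob_playable G s = {a \<in> rob_actions G. (\<Sum>t\<in>states G. rob_trans G s a t) = 1}"

locale gpcr_game =
  fixes G :: "('s, 'a) gpcr"
  assumes finite_states: "finite (states G)"
    and init_in_states: "init G \<in> states G"
    and final_subset: "final G \<subseteq> states G"
    and finite_cop_actions: "finite (cop_actions G)"
    and cop_actions_nonempty: "cop_actions G \<noteq> {}"
    and finite_rob_actions: "finite (rob_actions G)"
    and rob_actions_nonempty: "rob_actions G \<noteq> {}"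
    and cop_trans_range:
      "\<lbrakk>s \<in> states G; a \<in> cop_actions G; t \<in> states G\<rbrakk> \<Longrightarrow> cop_trans G s a t \<in> {0..1}"
    and rob_trans_range:
      "\<lbrakk>s \<in> states G; a \<in> rob_actions G; t \<in> states G\<rbrakk> \<Longrightarrow> rob_trans G s a t \<in> {0..1}"
    and cop_trans_sum:
      "\<lbrakk>s \<in> states G; a \<in> cop_actions G\<rbrakk> \<Longrightarrow> (\<Sum>t\<in>states G. cop_trans G s a t) \<in> {0, 1}"
    and rob_trans_sum:
      "\<lbrakk>s \<in> states G; a \<in> rob_actions G\<rbrakk> \<Longrightarrow> (\<Sum>t\<in>states G. rob_trans G s a t) \<in> {0, 1}"
    and cop_playable_nonempty: "s \<in> states G \<Longrightarrow> cop_playable G s \<noteq> {}"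
    and rob_playable_nonempty: "s \<in> states G \<Longrightarrow> rob_playable G s \<noteq> {}"
    and cop_final_absorbing:
      "\<lbrakk>s \<in> final G; a \<in> cop_playable G s\<rbrakk> \<Longrightarrow> cop_trans G s a s = 1"
    and rob_final_absorbing:
      "\<lbrakk>s \<in> final G; a \<in> rob_playable G s\<rbrakk> \<Longrightarrow> rob_trans G s a s = 1"

definition cop_value :: "('s, 'a) gpcr \<Rightarrow> ('s \<Rightarrow> real) \<Rightarrow> 's \<Rightarrow> 'a \<Rightarrow> real" where
  "cop_value G v s a =
     (\<Sum>s'\<in>states G. cop_trans G s a s' *
       (MIN a'\<in>rob_playable G s'. \<Sum>s''\<in>states G. rob_trans G s' a' s'' * v s''))"

primrec w :: "('s, 'a) gpcr \<Rightarrow> nat \<Rightarrow> 's \<Rightarrow> real" where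
  "w G 0 s = (if s \<in> final G then 1 else 0)"
| "w G (Suc n) s =
     (if s \<in> final G then 1 else (MAX a\<in>cop_playable G s. cop_value G (w G n) s a))"

definition w_inf :: "('s, 'a) gpcr \<Rightarrow> 's \<Rightarrow> real" where
  "w_inf G s = lim (\<lambda>n. w G n s)"

text \<open>
  A finite play \<open>s\<^sub>0 a\<^sub>0 s\<^sub>1 a\<^sub>1 \<dots> s\<^sub>n\<close> is encoded as its starting state \<open>s\<^sub>0\<close> together with the list
  \<open>[(a\<^sub>0, s\<^sub>1), \<dots>, (a\<^bsub>n-1\<^esub>, s\<^sub>n)]\<close>; the cops are to move iff that list has even length.
\<close>

type_synonym ('s, 'a) strategy = "'s \<Rightarrow> ('a \<times> 's) list \<Rightarrow> 'a"

definition current :: "'s \<Rightarrow> ('a \<times> 's) list \<Rightarrow> 's" where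
  "current s h = (if h = [] then s else snd (last h))"

definition cop_strategy :: "('s, 'a) gpcr \<Rightarrow> ('s, 'a) strategy \<Rightarrow> bool" where
  "cop_strategy G \<sigma> \<longleftrightarrow>
     (\<forall>s\<in>states G. \<forall>h. set h \<subseteq> actions G \<times> states G \<and> even (length h) \<longrightarrow>
        \<sigma> s h \<in> cop_playable G (current s h))"

definition rob_strategy :: "('s, 'a) gpcr \<Rightarrow> ('s, 'a) strategy \<Rightarrow> bool" where
  "rob_strategy G \<rho> \<longleftrightarrow>
     (\<forall>s\<in>states G. \<forall>h. set h \<subseteq> actions G \<times> states G \<and> odd (length h) \<longrightarrow>
        \<rho> s h \<in> rob_playable G (current s h))"

definition memoryless :: "('s \<Rightarrow> 'a) \<Rightarrow> ('s, 'a) strategy" where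
  "memoryless f = (\<lambda>s h. f (current s h))"

definition step_space :: "('s, 'a) gpcr \<Rightarrow> ('a \<times> 's) measure" where
  "step_space G = count_space (actions G \<times> states G)"

definition step_kernel ::
  "('s, 'a) gpcr \<Rightarrow> ('s, 'a) strategy \<Rightarrow> ('s, 'a) strategy \<Rightarrow> 's \<Rightarrow>
     nat \<Rightarrow> (nat \<Rightarrow> 'a \<times> 's) \<Rightarrow> ('a \<times> 's) measure" where
  "step_kernel G \<sigma> \<rho> s n \<omega> =
     (let h = map \<omega> [0..<n];
          a = (if even n then \<sigma> s h else \<rho> s h);
          T = (if even n then cop_trans G else rob_trans G)
      in point_measure (actions G \<times> states G)
           (\<lambda>(b, t). if b = a then ennreal (T (current s h) a t) else 0))"

text \<open>
  The law of the infinite play started in \<open>s\<close> with the cops to move, given by the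
  Ionescu-Tulcea theorem; its hypotheses are established in \<open>Ionescu_Tulcea_step_kernel\<close> below.
\<close>

definition play_measure ::
  "('s, 'a) gpcr \<Rightarrow> ('s, 'a) strategy \<Rightarrow> ('s, 'a) strategy \<Rightarrow> 's \<Rightarrow> (nat \<Rightarrow> 'a \<times> 's) measure" where
  "play_measure G \<sigma> \<rho> s =
     projective_family.lim UNIV
       (Ionescu_Tulcea.CI (step_kernel G \<sigma> \<rho> s) (\<lambda>_. step_space G)) (\<lambda>_. step_space G)"

definition win_prob ::
  "('s, 'a) gpcr \<Rightarrow> ('s, 'a) strategy \<Rightarrow> ('s, 'a) strategy \<Rightarrow> 's \<Rightarrow> real" where
  "win_prob G \<sigma> \<rho> s =
     measure (play_measure G \<sigma> \<rho> s)
       {\<omega> \<in> space (play_measure G \<sigma> \<rho> s). s \<in> final G \<or> (\<exists>n. snd (\<omega> n) \<in> final G)}"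

definition guaranteed_prob :: "('s, 'a) gpcr \<Rightarrow> ('s, 'a) strategy \<Rightarrow> 's \<Rightarrow> real" where
  "guaranteed_prob G \<sigma> s = (INF \<rho>\<in>{\<rho>. rob_strategy G \<rho>}. win_prob G \<sigma> \<rho> s)"

definition cop_optimal_from :: "('s, 'a) gpcr \<Rightarrow> ('s, 'a) strategy \<Rightarrow> 's \<Rightarrow> bool" where
  "cop_optimal_from G \<sigma> s \<longleftrightarrow>
     cop_strategy G \<sigma> \<and>
     (\<forall>\<tau>. cop_strategy G \<tau> \<longrightarrow> guaranteed_prob G \<tau> s \<le> guaranteed_prob G \<sigma> s)"

context gpcr_game
begin

lemma finite_actions: "finite (actions G)"
  by (simp add: actions_def finite_cop_actions finite_rob_actions)

lemma current_in_states:
  "s \<in> states G \<Longrightarrow> set h \<subseteq> actions G \<times> states G \<Longrightarrow> current s h \<in> states G"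
  using last_in_set[of h] by (metis current_def mem_Times_iff subsetD)

lemma prob_space_step_kernel:
  assumes "cop_strategy G \<sigma>" "rob_strategy G \<rho>" "s \<in> states G"
    and \<omega>: "\<omega> \<in> space (PiM {0..<n} (\<lambda>_. step_space G))"
  shows "prob_space (step_kernel G \<sigma> \<rho> s n \<omega>)"
proof -
  define h where "h = map \<omega> [0..<n]"
  define a where "a = (if even n then \<sigma> s h else \<rho> s h)"
  define T where "T = (if even n then cop_trans G else rob_trans G)"
  have h: "set h \<subseteq> actions G \<times> states G" "length h = n"
    using \<omega> by (auto simp: h_def space_PiM step_space_def PiE_iff)
  have cur: "current s h \<in> states G"
    using current_in_states assms(3) h(1) by blast
  have a: "a \<in> (if even n then cop_playable G (current s h) else rob_playable G (current s h))"
    using assms(1-3) h by (auto simp: a_def cop_strategy_def rob_strategy_def)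
  then have aA: "a \<in> actions G"
    by (auto simp: actions_def cop_playable_def rob_playable_def split: if_splits)
  have sum1: "(\<Sum>t\<in>states G. T (current s h) a t) = 1"
    using a by (auto simp: T_def cop_playable_def rob_playable_def split: if_splits)
  have nn: "0 \<le> T (current s h) a t" if "t \<in> states G" for t
    using a cur that cop_trans_range[of "current s h" a t] rob_trans_range[of "current s h" a t]
    by (auto simp: T_def cop_playable_def rob_playable_def split: if_splits)
  let ?f = "\<lambda>(b, t). if b = a then ennreal (T (current s h) a t) else 0"
  have "(\<Sum>x\<in>actions G \<times> states G. ?f x)
      = (\<Sum>b\<in>actions G. \<Sum>t\<in>states G. if b = a then ennreal (T (current s h) a t) else 0)"
    by (simp add: sum.cartesian_product)
  also have "\<dots> = (\<Sum>b\<in>actions G. if b = a then (\<Sum>t\<in>states G. ennreal (T (current s h) a t)) else 0)"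
    by (intro sum.cong) auto
  also have "\<dots> = (\<Sum>t\<in>states G. ennreal (T (current s h) a t))"
    using aA finite_actions by simp
  also have "\<dots> = 1"
    using nn sum1 by (simp add: sum_ennreal)
  finally have 1: "(\<Sum>x\<in>actions G \<times> states G. ?f x) = 1" .
  have eq: "step_kernel G \<sigma> \<rho> s n \<omega> = point_measure (actions G \<times> states G) ?f"
    unfolding step_kernel_def Let_def a_def T_def h_def ..
  show ?thesis
    unfolding eq using 1 finite_actions finite_states
    by (intro prob_spaceI) (simp add: emeasure_point_measure_finite space_point_measure)
qed

lemma Ionescu_Tulcea_step_kernel:
  assumes "cop_strategy G \<sigma>" "rob_strategy G \<rho>" "s \<in> states G"
  shows "Ionescu_Tulcea (step_kernel G \<sigma> \<rho> s) (\<lambda>_. step_space G)"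
proof (rule Ionescu_Tulcea.intro)
  fix n :: nat
  let ?A = "actions G \<times> states G"
  have fin: "finite ?A"
    using finite_actions finite_states by simp
  have "sets (PiM {0..<n} (\<lambda>_. step_space G)) = sets (count_space (PiE {0..<n} (\<lambda>_. ?A)))"
    unfolding step_space_def using fin by (subst count_space_PiM_finite) (auto intro: countable_finite)
  then have "measurable (PiM {0..<n} (\<lambda>_. step_space G)) (subprob_algebra (step_space G))
      = measurable (count_space (PiE {0..<n} (\<lambda>_. ?A))) (subprob_algebra (step_space G))"
    by (rule measurable_cong_sets) simp
  moreover have "step_kernel G \<sigma> \<rho> s n \<in> PiE {0..<n} (\<lambda>_. ?A) \<rightarrow> space (subprob_algebra (step_space G))"
  proof
    fix \<omega> assume "\<omega> \<in> PiE {0..<n} (\<lambda>_. ?A)"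
    then have "prob_space (step_kernel G \<sigma> \<rho> s n \<omega>)"
      using assms by (intro prob_space_step_kernel) (auto simp: space_PiM step_space_def)
    moreover have "sets (step_kernel G \<sigma> \<rho> s n \<omega>) = sets (step_space G)"
      by (simp add: step_kernel_def Let_def sets_point_measure step_space_def)
    ultimately show "step_kernel G \<sigma> \<rho> s n \<omega> \<in> space (subprob_algebra (step_space G))"
      by (simp add: space_subprob_algebra prob_space_imp_subprob_space)
  qed
  ultimately show "step_kernel G \<sigma> \<rho> s n \<in>
      measurable (PiM {0..<n} (\<lambda>_. step_space G)) (subprob_algebra (step_space G))"
    by simp
qed (use assms in \<open>rule prob_space_step_kernel\<close>)

end

end

theory Submission
  imports Defs
begin

text \<open>
  A maximising action for \<open>w\<^sub>\<infinity>\<close> need not make progress towards a final state, so an arbitrary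
  choice of maximisers may fail to be optimal. Discounting the reward by \<open>\<beta> < 1\<close> per round removes
  the problem: the discounted value \<open>v\<^sub>\<beta>\<close> is a fixed point, and a memoryless strategy maximising for
  \<open>v\<^sub>\<beta>\<close> reaches a final state within \<open>k\<close> rounds with probability at least \<open>v\<^sub>\<beta> - \<beta>\<^sup>k\<close> against every
  robber. As there are finitely many memoryless strategies, a single one is optimal for a sequence
  \<open>\<beta> \<rightarrow> 1\<close>; along it \<open>v\<^sub>\<beta> \<rightarrow> w\<^sub>\<infinity>\<close>, so that this strategy guarantees \<open>w\<^sub>\<infinity>\<close> and, by continuity, is
  maximising for \<open>w\<^sub>\<infinity>\<close>. Conversely, a robber minimising for \<open>w\<^sub>\<infinity>\<close> makes \<open>w\<^sub>\<infinity>\<close> a supermartingale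
  along the play, so no cop strategy guarantees more.
\<close>

subsection \<open>The discounted recursion\<close>

lemma tendsto_MIN:
  fixes f :: "'b \<Rightarrow> 'c \<Rightarrow> real"
  assumes "finite A" "A \<noteq> {}" "\<And>a. a \<in> A \<Longrightarrow> (f a \<longlongrightarrow> l a) F"
  shows "((\<lambda>x. MIN a\<in>A. f a x) \<longlongrightarrow> (MIN a\<in>A. l a)) F"
  using assms
proof (induction A rule: finite_ne_induct)
  case (insert a A)
  then show ?case by (simp add: tendsto_min)
qed simp

lemma tendsto_MAX:
  fixes f :: "'b \<Rightarrow> 'c \<Rightarrow> real"
  assumes "finite A" "A \<noteq> {}" "\<And>a. a \<in> A \<Longrightarrow> (f a \<longlongrightarrow> l a) F"
  shows "((\<lambda>x. MAX a\<in>A. f a x) \<longlongrightarrow> (MAX a\<in>A. l a)) F"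
  using assms
proof (induction A rule: finite_ne_induct)
  case (insert a A)
  then show ?case by (simp add: tendsto_max)
qed simp

lemma MIN_mono:
  fixes f g :: "'b \<Rightarrow> real"
  assumes "finite A" "A \<noteq> {}" "\<And>a. a \<in> A \<Longrightarrow> f a \<le> g a"
  shows "(MIN a\<in>A. f a) \<le> (MIN a\<in>A. g a)"
  using assms by (subst Min_ge_iff) (auto simp: Min_le_iff)

lemma MAX_mono:
  fixes f g :: "'b \<Rightarrow> real"
  assumes "finite A" "A \<noteq> {}" "\<And>a. a \<in> A \<Longrightarrow> f a \<le> g a"
  shows "(MAX a\<in>A. f a) \<le> (MAX a\<in>A. g a)"
  using assms by (subst Max_le_iff) (auto simp: Max_ge_iff)

lemma finite_arg_max_exists:
  fixes f :: "'b \<Rightarrow> real"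
  assumes "finite A" "A \<noteq> {}"
  shows "\<exists>a\<in>A. f a = (MAX a\<in>A. f a)"
  proof -
  have "(MAX a\<in>A. f a) \<in> f ` A"
    using assms by (intro Max_in) auto
  then show ?thesis by (metis imageE)
qed

lemma finite_arg_min_exists:
  fixes f :: "'b \<Rightarrow> real"
  assumes "finite A" "A \<noteq> {}"
  shows "\<exists>a\<in>A. f a = (MIN a\<in>A. f a)"
  proof -
  have "(MIN a\<in>A. f a) \<in> f ` A"
    using assms by (intro Min_in) auto
  then show ?thesis by (metis imageE)
qed

section \<open>One-step operators and discounted iterates\<close>

definition rob_exp :: "('s, 'a) gpcr \<Rightarrow> ('s \<Rightarrow> real) \<Rightarrow> 's \<Rightarrow> 'a \<Rightarrow> real" where
  "rob_exp G v s a = (\<Sum>t\<in>states G. rob_trans G s a t * v t)"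

definition rob_value :: "('s, 'a) gpcr \<Rightarrow> ('s \<Rightarrow> real) \<Rightarrow> 's \<Rightarrow> real" where
  "rob_value G v s = (MIN a\<in>rob_playable G s. rob_exp G v s a)"

lemma cop_value_eq:
  "cop_value G v s a = (\<Sum>t\<in>states G. cop_trans G s a t * rob_value G v t)"
  by (simp add: cop_value_def rob_value_def rob_exp_def)

primrec disc_w :: "('s, 'a) gpcr \<Rightarrow> real \<Rightarrow> nat \<Rightarrow> 's \<Rightarrow> real" where
  "disc_w G \<beta> 0 s = (if s \<in> final G then 1 else 0)"
| "disc_w G \<beta> (Suc n) s =
     (if s \<in> final G then 1
      else \<beta> * (MAX a\<in>cop_playable G s. cop_value G (disc_w G \<beta> n) s a))"

definition disc_value :: "('s, 'a) gpcr \<Rightarrow> real \<Rightarrow> 's \<Rightarrow> real" where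
  "disc_value G \<beta> s = lim (\<lambda>n. disc_w G \<beta> n s)"

lemma disc_w_1: "disc_w G 1 n = w G n"
proof (induction n)
  case (Suc n)
  then show ?case by (intro ext) simp
qed (simp add: fun_eq_iff)

lemma disc_value_1: "disc_value G 1 = w_inf G"
  by (simp add: fun_eq_iff disc_value_def w_inf_def disc_w_1)

context gpcr_game
begin

lemma finite_cop_playable: "finite (cop_playable G s)"
  by (simp add: cop_playable_def finite_cop_actions)

lemma finite_rob_playable: "finite (rob_playable G s)"
  by (simp add: rob_playable_def finite_rob_actions)

lemma cop_trans_nonneg:
  "s \<in> states G \<Longrightarrow> a \<in> cop_playable G s \<Longrightarrow> t \<in> states G \<Longrightarrow> 0 \<le> cop_trans G s a t"
  using cop_trans_range[of s a t] by (auto simp: cop_playable_def)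

lemma rob_trans_nonneg:
  "s \<in> states G \<Longrightarrow> a \<in> rob_playable G s \<Longrightarrow> t \<in> states G \<Longrightarrow> 0 \<le> rob_trans G s a t"
  using rob_trans_range[of s a t] by (auto simp: rob_playable_def)

lemma cop_trans_sum_1: "a \<in> cop_playable G s \<Longrightarrow> (\<Sum>t\<in>states G. cop_trans G s a t) = 1"
  by (simp add: cop_playable_def)

lemma rob_trans_sum_1: "a \<in> rob_playable G s \<Longrightarrow> (\<Sum>t\<in>states G. rob_trans G s a t) = 1"
  by (simp add: rob_playable_def)

lemma rob_exp_mono:
  assumes "s \<in> states G" "a \<in> rob_playable G s" "\<And>t. t \<in> states G \<Longrightarrow> u t \<le> v t"
  shows "rob_exp G u s a \<le> rob_exp G v s a"
  unfolding rob_exp_def using assms by (intro sum_mono mult_left_mono rob_trans_nonneg) auto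

lemma rob_value_mono:
  assumes "s \<in> states G" "\<And>t. t \<in> states G \<Longrightarrow> u t \<le> v t"
  shows "rob_value G u s \<le> rob_value G v s"
  unfolding rob_value_def using assms
  by (intro MIN_mono finite_rob_playable rob_playable_nonempty rob_exp_mono) auto

lemma cop_value_mono:
  assumes "s \<in> states G" "a \<in> cop_playable G s" "\<And>t. t \<in> states G \<Longrightarrow> u t \<le> v t"
  shows "cop_value G u s a \<le> cop_value G v s a"
  unfolding cop_value_eq using assms
  by (intro sum_mono mult_left_mono cop_trans_nonneg rob_value_mono) auto

lemma rob_exp_const: "a \<in> rob_playable G s \<Longrightarrow> rob_exp G (\<lambda>_. c) s a = c"
  by (simp add: rob_exp_def rob_trans_sum_1 flip: sum_distrib_right)

lemma rob_value_const: "s \<in> states G \<Longrightarrow> rob_value G (\<lambda>_. c) s = c"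
  by (simp add: rob_value_def rob_exp_const rob_playable_nonempty image_constant_conv)

lemma cop_value_const:
  "a \<in> cop_playable G s \<Longrightarrow> cop_value G (\<lambda>_. c) s a = c"
  by (simp add: cop_value_eq rob_value_const cop_trans_sum_1 flip: sum_distrib_right)

lemma MAX_cop_value_mono:
  assumes "s \<in> states G" "\<And>t. t \<in> states G \<Longrightarrow> u t \<le> v t"
  shows "(MAX a\<in>cop_playable G s. cop_value G u s a) \<le> (MAX a\<in>cop_playable G s. cop_value G v s a)"
  using assms by (intro MAX_mono finite_cop_playable cop_playable_nonempty cop_value_mono) auto

text \<open>The operator is monotone and fixes constants, since the rows of playable actions sum to
  1; it therefore preserves the bounds 0 and 1.\<close>

lemma MAX_cop_value_bounds:
  assumes s: "s \<in> states G" and v: "\<And>t. t \<in> states G \<Longrightarrow> v t \<in> {0..1}"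
  shows "(MAX a\<in>cop_playable G s. cop_value G v s a) \<in> {0..1}"
  using MAX_cop_value_mono[OF s, of "\<lambda>_. 0" v] MAX_cop_value_mono[OF s, of v "\<lambda>_. 1"] v s
  by (simp add: cop_value_const cop_playable_nonempty image_constant_conv)

lemma tendsto_rob_value:
  assumes "s \<in> states G" "\<And>t. t \<in> states G \<Longrightarrow> ((\<lambda>x. u x t) \<longlongrightarrow> v t) F"
  shows "((\<lambda>x. rob_value G (u x) s) \<longlongrightarrow> rob_value G v s) F"
  unfolding rob_value_def rob_exp_def using assms
  by (intro tendsto_MIN finite_rob_playable rob_playable_nonempty tendsto_intros) auto

lemma tendsto_cop_value:
  assumes "\<And>t. t \<in> states G \<Longrightarrow> ((\<lambda>x. u x t) \<longlongrightarrow> v t) F"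
  shows "((\<lambda>x. cop_value G (u x) s a) \<longlongrightarrow> cop_value G v s a) F"
  unfolding cop_value_eq using assms
  by (intro tendsto_intros tendsto_rob_value) auto

lemma tendsto_MAX_cop_value:
  assumes "s \<in> states G" "\<And>t. t \<in> states G \<Longrightarrow> ((\<lambda>x. u x t) \<longlongrightarrow> v t) F"
  shows "((\<lambda>x. MAX a\<in>cop_playable G s. cop_value G (u x) s a)
    \<longlongrightarrow> (MAX a\<in>cop_playable G s. cop_value G v s a)) F"
  using assms by (intro tendsto_MAX finite_cop_playable cop_playable_nonempty tendsto_cop_value)

section \<open>Discounted values and their limit for discount factors tending to 1\<close>

lemma disc_w_bounds:
  assumes "\<beta> \<in> {0..1}" "s \<in> states G"
  shows "disc_w G \<beta> n s \<in> {0..1}"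
  using assms(2)
proof (induction n arbitrary: s)
  case (Suc n)
  then show ?case
    using MAX_cop_value_bounds[of s "disc_w G \<beta> n"] assms(1) by (auto intro: mult_le_one)
qed simp

text \<open>The iteration starts from the indicator of F, the least function with values in [0,1]
  that is 1 on F; monotonicity of the operator propagates the first inequality.\<close>

lemma disc_w_Suc_mono:
  assumes "\<beta> \<in> {0..1}" "s \<in> states G"
  shows "disc_w G \<beta> n s \<le> disc_w G \<beta> (Suc n) s"
  using assms(2)
proof (induction n arbitrary: s)
  case 0
  then show ?case
    using disc_w_bounds[OF assms(1) 0, of 1] by (simp split: if_splits)
next
  case (Suc n)
  then show ?case
    unfolding disc_w.simps(2)[of G \<beta> _ s]
    using MAX_cop_value_mono[OF Suc.prems Suc.IH] assms(1)
    by (auto intro!: mult_left_mono simp del: disc_w.simps)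
qed

lemma disc_w_mono_discount:
  assumes "\<beta> \<in> {0..1}" "s \<in> states G"
  shows "disc_w G \<beta> n s \<le> disc_w G 1 n s"
  using assms(2)
proof (induction n arbitrary: s)
  case (Suc n)
  have "disc_w G \<beta> n t \<in> {0..1}" if "t \<in> states G" for t
    using disc_w_bounds assms(1) that .
  then have "\<beta> * (MAX a\<in>cop_playable G s. cop_value G (disc_w G \<beta> n) s a)
      \<le> 1 * (MAX a\<in>cop_playable G s. cop_value G (disc_w G 1 n) s a)"
    using assms(1) Suc MAX_cop_value_bounds[OF Suc.prems] MAX_cop_value_mono[OF Suc.prems Suc.IH]
    by (intro mult_mono) auto
  then show ?case by simp
qed simp

lemma disc_w_LIMSEQ:
  assumes "\<beta> \<in> {0..1}" "s \<in> states G"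
  shows "(\<lambda>n. disc_w G \<beta> n s) \<longlonglongrightarrow> disc_value G \<beta> s"
proof -
  have "incseq (\<lambda>n. disc_w G \<beta> n s)"
    using disc_w_Suc_mono[OF assms] by (rule incseq_SucI)
  moreover have "disc_w G \<beta> n s \<le> 1" for n
    using disc_w_bounds[OF assms] by simp
  ultimately have "convergent (\<lambda>n. disc_w G \<beta> n s)"
    using incseq_convergent unfolding convergent_def by metis
  then show ?thesis
    by (simp add: disc_value_def convergent_LIMSEQ_iff)
qed

lemma disc_w_le_disc_value:
  assumes "\<beta> \<in> {0..1}" "s \<in> states G"
  shows "disc_w G \<beta> n s \<le> disc_value G \<beta> s"
  using incseq_le[OF incseq_SucI disc_w_LIMSEQ] disc_w_Suc_mono assms by metis

lemma disc_value_bounds: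
  assumes "\<beta> \<in> {0..1}" "s \<in> states G"
  shows "disc_value G \<beta> s \<in> {0..1}"
  using disc_w_bounds[OF assms] disc_w_LIMSEQ[OF assms]
  by (auto intro: LIMSEQ_le_const LIMSEQ_le_const2)

text \<open>Finite sums, minima and maxima are continuous, so the limit in \<open>n\<close> passes
  through the recursion; the shifted sequence then has both sides as limits.\<close>

lemma disc_value_fixpoint:
  assumes "\<beta> \<in> {0..1}" "s \<in> states G"
  shows "disc_value G \<beta> s =
    (if s \<in> final G then 1
     else \<beta> * (MAX a\<in>cop_playable G s. cop_value G (disc_value G \<beta>) s a))"
proof (rule LIMSEQ_unique)
  show "(\<lambda>n. disc_w G \<beta> (Suc n) s) \<longlonglongrightarrow> disc_value G \<beta> s"
    using disc_w_LIMSEQ[OF assms] by (rule LIMSEQ_Suc)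
  show "(\<lambda>n. disc_w G \<beta> (Suc n) s) \<longlonglongrightarrow> (if s \<in> final G then 1
     else \<beta> * (MAX a\<in>cop_playable G s. cop_value G (disc_value G \<beta>) s a))"
    using assms by (auto intro!: tendsto_mult_left tendsto_MAX_cop_value disc_w_LIMSEQ)
qed

lemma disc_w_tendsto_w:
  assumes "b \<longlonglongrightarrow> 1" "s \<in> states G"
  shows "(\<lambda>k. disc_w G (b k) n s) \<longlonglongrightarrow> w G n s"
  using assms(2)
proof (induction n arbitrary: s)
  case (Suc n)
  then show ?case
    using tendsto_mult[OF assms(1) tendsto_MAX_cop_value[OF Suc.prems Suc.IH]] by simp
qed simp

text \<open>This exchanges the limits in the horizon and in the discount. From below, a finite
  horizon \<open>n\<close> already gets \<open>w G n s\<close> above \<open>x\<close>, and at fixed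
  \<open>n\<close> the iterate is continuous in \<beta>. From above, discounting only lowers
  values.\<close>

lemma disc_value_tendsto_w_inf:
  assumes "b \<longlonglongrightarrow> 1" "\<And>k. b k \<in> {0..1}" "s \<in> states G"
  shows "(\<lambda>k. disc_value G (b k) s) \<longlonglongrightarrow> w_inf G s"
proof (rule order_tendstoI)
  have w: "(\<lambda>n. w G n s) \<longlonglongrightarrow> w_inf G s"
    using disc_w_LIMSEQ[of 1, OF _ assms(3)] by (simp add: disc_w_1 disc_value_1)
  fix x assume "x < w_inf G s"
  then obtain n where "x < w G n s"
    using order_tendstoD(1)[OF w] by (meson eventually_sequentially order_refl)
  then have "\<forall>\<^sub>F k in sequentially. x < disc_w G (b k) n s"
    using order_tendstoD(1)[OF disc_w_tendsto_w[OF assms(1,3)]] by blast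
  then show "\<forall>\<^sub>F k in sequentially. x < disc_value G (b k) s"
    by eventually_elim (rule less_le_trans[OF _ disc_w_le_disc_value[OF assms(2,3)]])
next
  fix x assume x: "w_inf G s < x"
  have "disc_value G (b k) s \<le> disc_value G 1 s" for k
    using disc_w_mono_discount[OF assms(2,3)] assms(2,3)
    by (intro LIMSEQ_le[OF disc_w_LIMSEQ disc_w_LIMSEQ]) auto
  then show "\<forall>\<^sub>F k in sequentially. disc_value G (b k) s < x"
    using le_less_trans[OF _ x] by (intro always_eventually) (simp add: disc_value_1)
qed

text \<open>All mass of a playable action stays at \<open>s\<close>: the remaining probabilities are
  nonnegative and sum to 0. Hence a final state entered by a cop move keeps its value through the
  robber's turn.\<close>

lemma rob_value_final:
  assumes "s \<in> final G"
  shows "rob_value G v s = v s"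
proof -
  have s: "s \<in> states G" using assms final_subset by auto
  have "rob_exp G v s a = v s" if a: "a \<in> rob_playable G s" for a
  proof -
    have "(\<Sum>t\<in>states G - {s}. rob_trans G s a t) = 0"
      using rob_trans_sum_1[OF a] rob_final_absorbing[OF assms a] finite_states s
      by (simp add: sum_diff1)
    then have "\<forall>t\<in>states G - {s}. rob_trans G s a t = 0"
      using finite_states rob_trans_nonneg[OF s a] by (subst (asm) sum_nonneg_eq_0_iff) auto
    then have "(\<Sum>t\<in>states G - {s}. rob_trans G s a t * v t) = 0"
      by simp
    then show ?thesis
      using rob_final_absorbing[OF assms a] finite_states s by (simp add: rob_exp_def sum_diff1)
  qed
  then show ?thesis
    by (simp add: rob_value_def rob_playable_nonempty s image_constant_conv)
qed

end

subsection \<open>Finite-horizon hitting probabilities\<close>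

definition visited :: "('s, 'a) gpcr \<Rightarrow> 's \<Rightarrow> ('a \<times> 's) list \<Rightarrow> bool" where
  "visited G s h \<longleftrightarrow> s \<in> final G \<or> (\<exists>x\<in>set h. snd x \<in> final G)"

definition move :: "('s, 'a) strategy \<Rightarrow> ('s, 'a) strategy \<Rightarrow> 's \<Rightarrow> ('a \<times> 's) list \<Rightarrow> 'a" where
  "move \<sigma> \<rho> s h = (if even (length h) then \<sigma> s h else \<rho> s h)"

definition trans_prob ::
  "('s, 'a) gpcr \<Rightarrow> ('s, 'a) strategy \<Rightarrow> ('s, 'a) strategy \<Rightarrow> 's \<Rightarrow> ('a \<times> 's) list \<Rightarrow> 's \<Rightarrow> real" where
  "trans_prob G \<sigma> \<rho> s h =
     (if even (length h) then cop_trans G else rob_trans G) (current s h) (move \<sigma> \<rho> s h)"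

text \<open>
  The probability that \<open>F\<close> has been visited after \<open>n\<close> further half-moves, given the history \<open>h\<close>.
\<close>

primrec hit_prob ::
  "('s, 'a) gpcr \<Rightarrow> ('s, 'a) strategy \<Rightarrow> ('s, 'a) strategy \<Rightarrow> 's \<Rightarrow> nat \<Rightarrow> ('a \<times> 's) list \<Rightarrow> real" where
  "hit_prob G \<sigma> \<rho> s 0 h = (if visited G s h then 1 else 0)"
| "hit_prob G \<sigma> \<rho> s (Suc n) h =
     (if visited G s h then 1
      else \<Sum>t\<in>states G. trans_prob G \<sigma> \<rho> s h t * hit_prob G \<sigma> \<rho> s n (h @ [(move \<sigma> \<rho> s h, t)]))"

lemma current_snoc [simp]: "current s (h @ [(a, t)]) = t"
  by (simp add: current_def)

lemma visited_snoc [simp]: "visited G s (h @ [(a, t)]) \<longleftrightarrow> visited G s h \<or> t \<in> final G"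
  by (auto simp: visited_def)

lemma visited_current: "current s h \<in> final G \<Longrightarrow> visited G s h"
  by (cases "h = []") (auto simp: visited_def current_def)

lemma hit_prob_visited: "visited G s h \<Longrightarrow> hit_prob G \<sigma> \<rho> s n h = 1"
  by (cases n) auto

locale gpcr_play = gpcr_game G for G :: "('s, 'a) gpcr" +
  fixes \<sigma> \<rho> :: "('s, 'a) strategy" and s :: 's
  assumes cop: "cop_strategy G \<sigma>" and rob: "rob_strategy G \<rho>" and start: "s \<in> states G"
begin

abbreviation "valid h \<equiv> set h \<subseteq> actions G \<times> states G"
abbreviation "mv \<equiv> move \<sigma> \<rho> s"
abbreviation "tp \<equiv> trans_prob G \<sigma> \<rho> s"
abbreviation "hp \<equiv> hit_prob G \<sigma> \<rho> s"

lemma move_playable: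
  assumes "valid h"
  shows "even (length h) \<Longrightarrow> mv h \<in> cop_playable G (current s h)"
    and "odd (length h) \<Longrightarrow> mv h \<in> rob_playable G (current s h)"
  using assms cop rob start by (auto simp: move_def cop_strategy_def rob_strategy_def)

lemma move_in_actions: "valid h \<Longrightarrow> mv h \<in> actions G"
  using move_playable[of h]
  by (cases "even (length h)") (auto simp: actions_def cop_playable_def rob_playable_def)

lemma valid_snoc: "valid h \<Longrightarrow> t \<in> states G \<Longrightarrow> valid (h @ [(mv h, t)])"
  using move_in_actions by auto

lemma current_state: "valid h \<Longrightarrow> current s h \<in> states G"
  using current_in_states start .

lemma trans_prob_nonneg: "valid h \<Longrightarrow> t \<in> states G \<Longrightarrow> 0 \<le> tp h t"
  using move_playable[of h] current_state[of h]
  by (auto simp: trans_prob_def cop_trans_nonneg rob_trans_nonneg)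

lemma trans_prob_sum: "valid h \<Longrightarrow> (\<Sum>t\<in>states G. tp h t) = 1"
  using move_playable[of h] by (auto simp: trans_prob_def cop_trans_sum_1 rob_trans_sum_1)

lemma hit_prob_nonneg: "valid h \<Longrightarrow> 0 \<le> hp n h"
proof (induction n arbitrary: h)
  case (Suc n)
  then show ?case
    using Suc.IH[OF valid_snoc] trans_prob_nonneg by (auto intro!: sum_nonneg)
qed simp

text \<open>The case distinction of the recursion disappears: once F has been visited, every summand
  has hitting probability 1 and the weights sum to 1.\<close>

lemma hit_prob_Suc:
  assumes "valid h"
  shows "hp (Suc n) h = (\<Sum>t\<in>states G. tp h t * hp n (h @ [(mv h, t)]))"
  using trans_prob_sum[OF assms] by (simp add: hit_prob_visited)

section \<open>The law of the play and its link to \<open>hit_prob\<close>\<close>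

sublocale IT: Ionescu_Tulcea "step_kernel G \<sigma> \<rho> s" "\<lambda>_. step_space G"
  using cop rob start by (rule Ionescu_Tulcea_step_kernel)

text \<open>The joint law of the first \<open>n\<close> half-moves. No coordinate is fixed at time
  0, and \<open>\<lambda>_. undefined\<close> is the only point of the product over the empty index
  set.\<close>

abbreviation "hist_law n \<equiv> IT.C 0 n (\<lambda>_. undefined)"

lemma finite_steps: "finite (actions G \<times> states G)"
  using finite_actions finite_states by simp

text \<open>There are finitely many steps, so the product sigma-algebra on finite histories is the
  full power set and every measurability condition on them is trivial.\<close>

lemma sets_PiM_steps:
  "sets (PiM {0..<n::nat} (\<lambda>_. step_space G)) = sets (count_space (PiE {0..<n} (\<lambda>_. actions G \<times> states G)))"
  unfolding step_space_def using finite_steps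
  by (subst count_space_PiM_finite) (auto intro: countable_finite)

lemma measurable_PiM_steps:
  "f \<in> borel_measurable (PiM {0..<n::nat} (\<lambda>_. step_space G))"
  unfolding measurable_cong_sets[OF sets_PiM_steps refl] by simp

lemma valid_map:
  "\<omega> \<in> space (PiM {0..<n} (\<lambda>_. step_space G)) \<Longrightarrow> valid (map \<omega> [0..<n])"
  by (auto simp: space_PiM step_space_def PiE_iff)

text \<open>The kernel is a measure on pairs concentrated on the prescribed action
  \<open>mv h\<close>, so the double sum collapses to the sum over successor states.\<close>

lemma nn_integral_step_kernel:
  assumes "valid h" "h = map \<omega> [0..<n]"
  shows "(\<integral>\<^sup>+x. g x \<partial>step_kernel G \<sigma> \<rho> s n \<omega>) = (\<Sum>t\<in>states G. ennreal (tp h t) * g (mv h, t))"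
proof -
  have n: "length h = n" using assms(2) by simp
  have "(\<integral>\<^sup>+x. g x \<partial>step_kernel G \<sigma> \<rho> s n \<omega>)
      = (\<Sum>x\<in>actions G \<times> states G. (case x of (b, t) \<Rightarrow> if b = mv h then ennreal (tp h t) else 0) * g x)"
    unfolding step_kernel_def Let_def assms(2)[symmetric]
    by (subst nn_integral_point_measure_finite[OF finite_steps])
      (auto intro!: sum.cong simp: move_def trans_prob_def n)
  also have "\<dots> = (\<Sum>b\<in>actions G. \<Sum>t\<in>states G. if b = mv h then ennreal (tp h t) * g (mv h, t) else 0)"
    by (subst sum.cartesian_product) (auto intro!: sum.cong)
  also have "\<dots> = (\<Sum>b\<in>actions G. if b = mv h then (\<Sum>t\<in>states G. ennreal (tp h t) * g (mv h, t)) else 0)"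
    by (intro sum.cong) auto
  also have "\<dots> = (\<Sum>t\<in>states G. ennreal (tp h t) * g (mv h, t))"
    using move_in_actions[OF assms(1)] finite_actions by simp
  finally show ?thesis .
qed

lemma space_hist_law: "space (hist_law n) = space (PiM {0..<n} (\<lambda>_. step_space G))"
  using IT.space_C[of "\<lambda>_. undefined" 0 n] by (simp add: space_PiM)

lemma sets_hist_law: "sets (hist_law n) = sets (PiM {0..<n} (\<lambda>_. step_space G))"
  using IT.sets_C[of "\<lambda>_. undefined" 0 n] by (simp add: space_PiM)

text \<open>Tower property: averaging the conditional hitting probability over the first
  \<open>n\<close> half-moves gives the unconditional one for \<open>n + k\<close>. Integrating out
  the last half-move turns \<open>k\<close> into \<open>Suc k\<close>, which is why \<open>k\<close>
  is generalised in the induction.\<close>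

lemma nn_integral_hit_prob:
  "(\<integral>\<^sup>+\<omega>. ennreal (hp k (map \<omega> [0..<n])) \<partial>hist_law n) = ennreal (hp (n + k) [])"
proof (induction n arbitrary: k)
  case 0
  show ?case
    by (simp only: IT.C.simps, subst nn_integral_return[OF _ measurable_PiM_steps])
      (simp_all add: space_PiM)
next
  case (Suc n)
  have "(\<integral>\<^sup>+\<omega>. ennreal (hp k (map \<omega> [0..<Suc n])) \<partial>hist_law (Suc n))
      = (\<integral>\<^sup>+\<omega>. (\<integral>\<^sup>+\<omega>'. ennreal (hp k (map \<omega>' [0..<Suc n])) \<partial>IT.eP n \<omega>) \<partial>hist_law n)"
    using IT.measurable_eP[of n]
    by (simp only: IT.C.simps add_0)
       (rule nn_integral_bind[OF measurable_PiM_steps[of _ "Suc n"]], simp add: measurable_cong_sets[OF sets_hist_law refl])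
  also have "\<dots> = (\<integral>\<^sup>+\<omega>. ennreal (hp (Suc k) (map \<omega> [0..<n])) \<partial>hist_law n)"
  proof (rule nn_integral_cong)
    fix \<omega> assume "\<omega> \<in> space (hist_law n)"
    then have \<omega>: "\<omega> \<in> space (PiM {0..<n} (\<lambda>_. step_space G))"
      by (simp add: space_hist_law)
    define h where "h = map \<omega> [0..<n]"
    have h: "valid h" using valid_map[OF \<omega>] by (simp add: h_def)
    have "map (fun_upd \<omega> n x) [0..<Suc n] = h @ [x]" for x
      by (auto simp: h_def)
    then have "(\<integral>\<^sup>+\<omega>'. ennreal (hp k (map \<omega>' [0..<Suc n])) \<partial>IT.eP n \<omega>)
        = (\<integral>\<^sup>+x. ennreal (hp k (h @ [x])) \<partial>step_kernel G \<sigma> \<rho> s n \<omega>)"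
      using IT.nn_integral_eP[OF \<omega> measurable_PiM_steps] by simp
    also have "\<dots> = (\<Sum>t\<in>states G. ennreal (tp h t) * ennreal (hp k (h @ [(mv h, t)])))"
      using nn_integral_step_kernel[OF h h_def] .
    also have "\<dots> = (\<Sum>t\<in>states G. ennreal (tp h t * hp k (h @ [(mv h, t)])))"
      using h by (intro sum.cong refl ennreal_mult[symmetric] trans_prob_nonneg hit_prob_nonneg valid_snoc)
    also have "\<dots> = ennreal (hp (Suc k) h)"
      unfolding hit_prob_Suc[OF h] using h
      by (intro sum_ennreal mult_nonneg_nonneg trans_prob_nonneg hit_prob_nonneg valid_snoc)
    finally show "(\<integral>\<^sup>+\<omega>'. ennreal (hp k (map \<omega>' [0..<Suc n])) \<partial>IT.eP n \<omega>)
        = ennreal (hp (Suc k) (map \<omega> [0..<n]))"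
      by (simp only: h_def)
  qed
  also have "\<dots> = ennreal (hp (Suc n + k) [])"
    using Suc.IH[of "Suc k"] by simp
  finally show ?case .
qed

lemma play_measure_eq: "play_measure G \<sigma> \<rho> s = IT.PF.lim"
  by (simp add: play_measure_def)

text \<open>A visit within \<open>n\<close> half-moves depends only on the first \<open>n\<close>
  coordinates, so the event is a cylinder whose measure can be computed from a finite-dimensional
  marginal.\<close>

lemma visited_cylinder:
  defines "X n \<equiv> {\<omega> \<in> space (PiM {0..<n} (\<lambda>_. step_space G)). visited G s (map \<omega> [0..<n])}"
  shows "X n \<in> sets (PiM {0..<n} (\<lambda>_. step_space G))"
    and "{\<omega> \<in> space (play_measure G \<sigma> \<rho> s). visited G s (map \<omega> [0..<n])}
      = prod_emb UNIV (\<lambda>_. step_space G) {0..<n} (X n)"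
proof -
  show "X n \<in> sets (PiM {0..<n} (\<lambda>_. step_space G))"
    unfolding sets_PiM_steps by (auto simp: X_def space_PiM step_space_def)
  show "{\<omega> \<in> space (play_measure G \<sigma> \<rho> s). visited G s (map \<omega> [0..<n])}
      = prod_emb UNIV (\<lambda>_. step_space G) {0..<n} (X n)"
    by (auto simp: play_measure_eq prod_emb_def X_def space_PiM visited_def PiE_iff)
qed

lemma emeasure_visited:
  "emeasure (play_measure G \<sigma> \<rho> s)
     {\<omega> \<in> space (play_measure G \<sigma> \<rho> s). visited G s (map \<omega> [0..<n])} = ennreal (hp n [])"
proof -
  let ?P = "PiM {0..<n} (\<lambda>_. step_space G)"
  define X where "X = {\<omega> \<in> space ?P. visited G s (map \<omega> [0..<n])}"
  have X: "X \<in> sets ?P"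
    using visited_cylinder(1) by (simp add: X_def)
  have emb: "{\<omega> \<in> space (play_measure G \<sigma> \<rho> s). visited G s (map \<omega> [0..<n])}
      = prod_emb UNIV (\<lambda>_. step_space G) {0..<n} X"
    unfolding X_def by (rule visited_cylinder(2))
  have emb_id: "prod_emb {0..<n} (\<lambda>_. step_space G) {0..<n} X = X"
    using sets.sets_into_space[OF X] by (intro prod_emb_id) (simp add: space_PiM)
  \<comment> \<open>The projective limit has the marginals \<open>IT.CI\<close>, and on the initial
    segment \<open>{0..<n}\<close> this marginal is \<open>hist_law n\<close>.\<close>
  have "emeasure IT.PF.lim (prod_emb UNIV (\<lambda>_. step_space G) {0..<n} X) = emeasure (hist_law n) X"
    using IT.lim[OF _ X] IT.emeasure_CI[OF subset_refl X] emb_id by simp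
  also have "\<dots> = (\<integral>\<^sup>+\<omega>. indicator X \<omega> \<partial>hist_law n)"
    using X by (simp add: sets_hist_law)
  \<comment> \<open>With no half-move left, \<open>hp 0\<close> is the indicator of having visited
    F.\<close>
  also have "\<dots> = (\<integral>\<^sup>+\<omega>. ennreal (hp 0 (map \<omega> [0..<n])) \<partial>hist_law n)"
    by (intro nn_integral_cong) (auto simp: X_def space_hist_law)
  also have "\<dots> = ennreal (hp n [])"
    using nn_integral_hit_prob[where k = 0 and n = n] by (simp only: add_0_right)
  finally show ?thesis unfolding emb by (simp only: play_measure_eq)
qed

lemma visited_sets:
  "{\<omega> \<in> space (play_measure G \<sigma> \<rho> s). visited G s (map \<omega> [0..<n])} \<in> sets (play_measure G \<sigma> \<rho> s)"
  unfolding visited_cylinder(2) using visited_cylinder(1)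
  by (simp add: play_measure_eq)

lemma hit_prob_tendsto_win_prob: "(\<lambda>n. hp n []) \<longlonglongrightarrow> win_prob G \<sigma> \<rho> s"
proof -
  let ?M = "play_measure G \<sigma> \<rho> s"
  let ?V = "\<lambda>n. {\<omega> \<in> space ?M. visited G s (map \<omega> [0..<n])}"
  \<comment> \<open>The total mass is preserved by projecting onto the empty index set, where the
    marginal is known to be a probability measure.\<close>
  interpret M: prob_space ?M
    unfolding play_measure_eq
  proof (rule prob_space_distrD)
    show "prob_space (distr IT.PF.lim (PiM {} (\<lambda>_. step_space G)) (\<lambda>\<omega>. restrict \<omega> {}))"
      using IT.distr_lim[of "{}"] IT.PF.prob_space_P[of "{}"] by simp
  qed (auto intro: measurable_restrict simp: measurable_cong_sets[OF IT.PF.sets_lim refl])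
  have "incseq ?V"
    by (rule incseq_SucI) (auto simp: visited_def)
  then have "(\<lambda>n. M.prob (?V n)) \<longlonglongrightarrow> M.prob (\<Union>n. ?V n)"
    using visited_sets by (intro M.finite_Lim_measure_incseq) auto
  \<comment> \<open>A visit at coordinate \<open>n\<close> is first seen in the prefix of length
    \<open>Suc n\<close>.\<close>
  moreover have "(\<Union>n. ?V n) = {\<omega> \<in> space ?M. s \<in> final G \<or> (\<exists>n. snd (\<omega> n) \<in> final G)}"
    by (auto simp: visited_def) (meson atLeastLessThan_iff le0 lessI)
  moreover have "M.prob (?V n) = hp n []" for n
    using emeasure_visited[of n] hit_prob_nonneg[of "[]" n] by (simp add: measure_def)
  ultimately show ?thesis
    by (simp add: win_prob_def)
qed

end

subsection \<open>Bounds on the winning probability\<close>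

context gpcr_play
begin

text \<open>Supermartingale bound, by induction over rounds of two half-moves. Unvisitedness is
  required because \<open>valid\<close> also admits histories that leave F along transitions of
  probability 0; there \<open>hp\<close> is 1 while \<open>v\<close> of the current state may be
  smaller.\<close>

lemma hit_prob_le:
  assumes v_final: "\<And>t. t \<in> final G \<Longrightarrow> v t = 1"
    and v_nonneg: "\<And>t. t \<in> states G \<Longrightarrow> 0 \<le> v t"
    and cop_le: "\<And>t a. t \<in> states G - final G \<Longrightarrow> a \<in> cop_playable G t \<Longrightarrow> cop_value G v t a \<le> v t"
    and rob_le: "\<And>h. valid h \<Longrightarrow> odd (length h) \<Longrightarrow>
      rob_exp G v (current s h) (\<rho> s h) \<le> rob_value G v (current s h)"
  shows "valid h \<Longrightarrow> even (length h) \<Longrightarrow> \<not> visited G s h \<Longrightarrow> hp (2 * k) h \<le> v (current s h)"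
proof (induction k arbitrary: h)
  case 0
  then show ?case using v_nonneg current_state by simp
next
  case (Suc k)
  let ?h = "\<lambda>t. h @ [(mv h, t)]"
  have 1: "hp (Suc (2 * k)) (?h t) \<le> rob_value G v t" if t: "t \<in> states G" for t
  proof (cases "t \<in> final G")
    case True
    then show ?thesis using v_final by (simp add: hit_prob_visited rob_value_final del: hit_prob.simps)
  next
    case False
    have h: "valid (?h t)" using valid_snoc[OF Suc.prems(1) t] .
    \<comment> \<open>If \<open>u\<close> is final, both sides equal 1; otherwise the extended
      history is still unvisited and the induction hypothesis applies.\<close>
    have "hp (2 * k) (?h t @ [(mv (?h t), u)]) \<le> v u" if u: "u \<in> states G" for u
      using Suc.IH[OF valid_snoc[OF h u]] Suc.prems False v_final[of u]
      by (cases "u \<in> final G") (auto simp: hit_prob_visited simp del: append_assoc)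
    then have "hp (Suc (2 * k)) (?h t) \<le> (\<Sum>u\<in>states G. tp (?h t) u * v u)"
      unfolding hit_prob_Suc[OF h]
      by (intro sum_mono mult_left_mono trans_prob_nonneg[OF h])
    also have "\<dots> = rob_exp G v t (\<rho> s (?h t))"
      using Suc.prems by (simp add: rob_exp_def trans_prob_def move_def)
    also have "\<dots> \<le> rob_value G v t"
      using rob_le[OF h] Suc.prems by simp
    finally show ?thesis .
  qed
  have "hp (2 * Suc k) h = (\<Sum>t\<in>states G. tp h t * hp (Suc (2 * k)) (?h t))"
    using hit_prob_Suc[OF Suc.prems(1), of "Suc (2 * k)"] by (simp del: hit_prob.simps)
  also have "\<dots> \<le> (\<Sum>t\<in>states G. tp h t * rob_value G v t)"
    using 1 Suc.prems by (intro sum_mono mult_left_mono trans_prob_nonneg)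
  also have "\<dots> = cop_value G v (current s h) (mv h)"
    using Suc.prems by (simp add: cop_value_eq trans_prob_def)
  also have "\<dots> \<le> v (current s h)"
    using Suc.prems visited_current[of s h G] current_state
    by (intro cop_le move_playable) auto
  finally show ?case .
qed

text \<open>Since \<open>v\<close> is at most 1, the bound is trivial at horizon 0 with error 1.
  Each round passes the error unchanged through the two expectations and then multiplies it by
  \<beta>.\<close>

lemma hit_prob_ge:
  assumes \<beta>: "\<beta> \<in> {0..1}"
    and v_le: "\<And>t. t \<in> states G \<Longrightarrow> v t \<le> 1"
    and cop_ge: "\<And>h. valid h \<Longrightarrow> even (length h) \<Longrightarrow> current s h \<notin> final G \<Longrightarrow>
      v (current s h) \<le> \<beta> * cop_value G v (current s h) (\<sigma> s h)"
  shows "valid h \<Longrightarrow> even (length h) \<Longrightarrow> v (current s h) - \<beta> ^ k \<le> hp (2 * k) h"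
proof (induction k arbitrary: h)
  case 0
  then show ?case
    using v_le[OF current_state[OF 0(1)]] by simp
next
  case (Suc k)
  let ?h = "\<lambda>t. h @ [(mv h, t)]"
  have 1: "rob_value G v t - \<beta> ^ k \<le> hp (Suc (2 * k)) (?h t)" if t: "t \<in> states G" for t
  proof -
    have h: "valid (?h t)" using valid_snoc[OF Suc.prems(1) t] .
    have rob: "mv (?h t) \<in> rob_playable G t"
      using move_playable(2)[OF h] Suc.prems by simp
    have "rob_value G v t \<le> rob_exp G v t (mv (?h t))"
      unfolding rob_value_def using rob finite_rob_playable by (intro Min_le) auto
    then have "rob_value G v t - \<beta> ^ k \<le> (\<Sum>u\<in>states G. tp (?h t) u * (v u - \<beta> ^ k))"
      using Suc.prems rob_trans_sum_1[OF rob]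
      by (simp add: right_diff_distrib sum_subtractf trans_prob_def rob_exp_def flip: sum_distrib_right)
    also have "\<dots> \<le> hp (Suc (2 * k)) (?h t)"
      unfolding hit_prob_Suc[OF h]
      using Suc.IH[OF valid_snoc[OF h]] Suc.prems
      by (intro sum_mono mult_left_mono trans_prob_nonneg[OF h]) (simp_all del: append_assoc)
    finally show ?thesis .
  qed
  let ?c = "cop_value G v (current s h) (mv h)"
  \<comment> \<open>The error is a constant, so it can be moved under an expectation whose weights
    sum to 1.\<close>
  have "?c - \<beta> ^ k = (\<Sum>t\<in>states G. tp h t * (rob_value G v t - \<beta> ^ k))"
    using Suc.prems cop_trans_sum_1[OF move_playable(1)[OF Suc.prems]]
    by (simp add: right_diff_distrib sum_subtractf trans_prob_def cop_value_eq flip: sum_distrib_right)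
  also have "\<dots> \<le> (\<Sum>t\<in>states G. tp h t * hp (Suc (2 * k)) (?h t))"
    using 1 Suc.prems by (intro sum_mono mult_left_mono trans_prob_nonneg)
  also have "\<dots> = hp (2 * Suc k) h"
    using hit_prob_Suc[OF Suc.prems(1), of "Suc (2 * k)"] by (simp del: hit_prob.simps)
  finally have 2: "?c - \<beta> ^ k \<le> hp (2 * Suc k) h" .
  show ?case
  proof (cases "current s h \<in> final G")
    case True
    then have "hp (2 * Suc k) h = 1"
      by (intro hit_prob_visited visited_current)
    moreover have "0 \<le> \<beta> ^ Suc k"
      using \<beta> by (intro zero_le_power) simp
    ultimately show ?thesis
      using v_le[OF current_state[OF Suc.prems(1)]] by linarith
  next
    case False
    \<comment> \<open>The factor \<beta> is first used to shrink the error and then dropped from the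
      nonnegative hitting probability, so the resulting bound concerns the undiscounted
      game.\<close>
    have "v (current s h) - \<beta> ^ Suc k \<le> \<beta> * (?c - \<beta> ^ k)"
      using cop_ge[OF Suc.prems False] Suc.prems by (simp add: move_def right_diff_distrib)
    also have "\<dots> \<le> \<beta> * hp (2 * Suc k) h"
      using 2 \<beta> by (intro mult_left_mono) auto
    also have "\<dots> \<le> hp (2 * Suc k) h"
      using \<beta> by (intro mult_left_le_one_le hit_prob_nonneg Suc.prems(1)) auto
    finally show ?thesis .
  qed
qed

lemma hit_prob_even_tendsto_win_prob: "(\<lambda>k. hp (2 * k) []) \<longlonglongrightarrow> win_prob G \<sigma> \<rho> s"
  using LIMSEQ_subseq_LIMSEQ[OF hit_prob_tendsto_win_prob, of "\<lambda>k. 2 * k"]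
  by (simp add: strict_mono_def comp_def)

lemma win_prob_le:
  assumes "\<And>t. t \<in> final G \<Longrightarrow> v t = 1"
    and "\<And>t. t \<in> states G \<Longrightarrow> 0 \<le> v t"
    and "\<And>t a. t \<in> states G - final G \<Longrightarrow> a \<in> cop_playable G t \<Longrightarrow> cop_value G v t a \<le> v t"
    and "\<And>h. valid h \<Longrightarrow> odd (length h) \<Longrightarrow>
      rob_exp G v (current s h) (\<rho> s h) \<le> rob_value G v (current s h)"
  shows "win_prob G \<sigma> \<rho> s \<le> v s"
proof -
  \<comment> \<open>A start in F is treated apart, since \<open>hit_prob_le\<close> speaks only of
    unvisited histories; there \<open>v s\<close> is 1.\<close>
  have "hp (2 * k) [] \<le> v s" for k
  proof (cases "visited G s []")
    case True
    then show ?thesis using assms(1) by (simp add: hit_prob_visited) (simp add: visited_def)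
  next
    case False
    then show ?thesis using hit_prob_le[of v "[]", OF assms] by (simp add: current_def)
  qed
  then show ?thesis
    using LIMSEQ_le_const2[OF hit_prob_even_tendsto_win_prob] by blast
qed

text \<open>Here \<beta> must be strictly below 1: then the error \<open>\<beta> ^ k\<close>
  vanishes, whereas for \<beta> = 1 the bound of \<open>hit_prob_ge\<close> would stay
  trivial.\<close>

lemma win_prob_ge:
  assumes "\<beta> \<in> {0..<1}"
    and "\<And>t. t \<in> states G \<Longrightarrow> v t \<le> 1"
    and "\<And>h. valid h \<Longrightarrow> even (length h) \<Longrightarrow> current s h \<notin> final G \<Longrightarrow>
      v (current s h) \<le> \<beta> * cop_value G v (current s h) (\<sigma> s h)"
  shows "v s \<le> win_prob G \<sigma> \<rho> s"
proof -
  have "(\<lambda>k. v s - \<beta> ^ k) \<longlonglongrightarrow> v s - 0"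
    using assms(1) by (intro tendsto_diff tendsto_const LIMSEQ_power_zero) auto
  moreover have "v s - \<beta> ^ k \<le> hp (2 * k) []" for k
    using hit_prob_ge[of \<beta> v "[]", OF _ assms(2,3)] assms(1) by (simp add: current_def)
  ultimately show ?thesis
    using LIMSEQ_le[OF _ hit_prob_even_tendsto_win_prob] by fastforce
qed

end

section \<open>Optimal play of the robber and of the cops\<close>

context gpcr_game
begin

lemma w_inf_bounds: "s \<in> states G \<Longrightarrow> w_inf G s \<in> {0..1}"
  using disc_value_bounds[of 1 s] by (simp add: disc_value_1)

lemma w_inf_fixpoint:
  "s \<in> states G \<Longrightarrow> w_inf G s =
    (if s \<in> final G then 1 else (MAX a\<in>cop_playable G s. cop_value G (w_inf G) s a))"
  using disc_value_fixpoint[of 1 s] by (simp add: disc_value_1)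

lemma memoryless_cop_strategy:
  "(\<And>t. t \<in> states G \<Longrightarrow> f t \<in> cop_playable G t) \<Longrightarrow> cop_strategy G (memoryless f)"
  by (auto simp: cop_strategy_def memoryless_def current_in_states)

lemma memoryless_rob_strategy:
  "(\<And>t. t \<in> states G \<Longrightarrow> g t \<in> rob_playable G t) \<Longrightarrow> rob_strategy G (memoryless g)"
  by (auto simp: rob_strategy_def memoryless_def current_in_states)

lemma rob_optimal_exists:
  "\<exists>g. rob_strategy G (memoryless g) \<and>
    (\<forall>t\<in>states G. rob_exp G v t (g t) = rob_value G v t)"
proof -
  have "\<exists>a\<in>rob_playable G t. rob_exp G v t a = rob_value G v t" if "t \<in> states G" for t
    unfolding rob_value_def using that
    by (intro finite_arg_min_exists finite_rob_playable rob_playable_nonempty)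
  then obtain g where "\<And>t. t \<in> states G \<Longrightarrow> g t \<in> rob_playable G t \<and> rob_exp G v t (g t) = rob_value G v t"
    by metis
  then show ?thesis
    by (intro exI[of _ g]) (auto intro: memoryless_rob_strategy)
qed

text \<open>A single memoryless robber that minimises for \<open>w_inf\<close> suffices against
  every history-dependent \<tau>: by the fixed-point equation no cop action raises
  \<open>w_inf\<close> on average over a round.\<close>

lemma guaranteed_prob_le_w_inf:
  assumes "cop_strategy G \<tau>" "s \<in> states G"
  shows "guaranteed_prob G \<tau> s \<le> w_inf G s"
proof -
  obtain g where g: "rob_strategy G (memoryless g)"
    and opt: "\<And>t. t \<in> states G \<Longrightarrow> rob_exp G (w_inf G) t (g t) = rob_value G (w_inf G) t"
    using rob_optimal_exists by blast
  interpret gpcr_play G \<tau> "memoryless g" s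
    using assms g by unfold_locales
  have "win_prob G \<tau> (memoryless g) s \<le> w_inf G s"
  proof (rule win_prob_le)
    fix t assume "t \<in> final G"
    then show "w_inf G t = 1" using w_inf_fixpoint final_subset by auto
  next
    fix t a assume "t \<in> states G - final G" "a \<in> cop_playable G t"
    then show "cop_value G (w_inf G) t a \<le> w_inf G t"
      using w_inf_fixpoint[of t] finite_cop_playable by (auto intro: Max_ge)
  qed (use w_inf_bounds opt current_state in \<open>auto simp: memoryless_def\<close>)
  moreover have "guaranteed_prob G \<tau> s \<le> win_prob G \<tau> (memoryless g) s"
    unfolding guaranteed_prob_def using g
    by (intro cINF_lower bdd_belowI[of _ 0]) (auto simp: win_prob_def)
  ultimately show ?thesis by simp
qed

lemma le_guaranteed_prob:
  assumes "\<And>\<rho>. rob_strategy G \<rho> \<Longrightarrow> c \<le> win_prob G \<sigma> \<rho> s"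
  shows "c \<le> guaranteed_prob G \<sigma> s"
  \<comment> \<open>The instance at the zero function only provides some robber strategy, so that
    the infimum ranges over a nonempty set.\<close>
  unfolding guaranteed_prob_def using assms rob_optimal_exists[of "\<lambda>_. 0"]
  by (intro cINF_greatest) auto

text \<open>For a maximising \<open>f\<close> the fixed-point equation of \<open>disc_value\<close>
  is the hypothesis of \<open>win_prob_ge\<close>, with equality outside F.\<close>

lemma disc_value_le_win_prob:
  assumes \<beta>: "\<beta> \<in> {0..<1}" and "s \<in> states G" and "rob_strategy G \<rho>"
    and f: "\<And>t. t \<in> states G \<Longrightarrow> f t \<in> cop_playable G t"
    and max: "\<And>t. t \<in> states G \<Longrightarrow>
      cop_value G (disc_value G \<beta>) t (f t) = (MAX a\<in>cop_playable G t. cop_value G (disc_value G \<beta>) t a)"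
  shows "disc_value G \<beta> s \<le> win_prob G (memoryless f) \<rho> s"
proof -
  interpret gpcr_play G "memoryless f" \<rho> s
    using assms memoryless_cop_strategy[of f] by unfold_locales auto
  show ?thesis
  proof (rule win_prob_ge[OF \<beta>])
    fix h assume "valid h" "current s h \<notin> final G"
    then show "disc_value G \<beta> (current s h)
        \<le> \<beta> * cop_value G (disc_value G \<beta>) (current s h) (memoryless f s h)"
      using disc_value_fixpoint[of \<beta> "current s h"] max \<beta> current_state by (simp add: memoryless_def)
  qed (use disc_value_bounds \<beta> in auto)
qed

text \<open>Pigeonhole: each discount factor in a sequence tending to 1 has a memoryless maximiser,
  and only finitely many such strategies exist, so one of them serves infinitely many
  factors.\<close>

lemma uniformly_optimal_exists:
  "\<exists>f b. (\<forall>t\<in>states G. f t \<in> cop_playable G t) \<and> b \<longlonglongrightarrow> 1 \<and> (\<forall>k. b k \<in> {0..<1}) \<and>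
    (\<forall>k. \<forall>t\<in>states G. cop_value G (disc_value G (b k)) t (f t)
      = (MAX a\<in>cop_playable G t. cop_value G (disc_value G (b k)) t a))"
proof -
  define c where "c k = 1 - inverse (real (Suc k))" for k
  have c: "c \<longlonglongrightarrow> 1"
    unfolding c_def using tendsto_diff[OF tendsto_const LIMSEQ_inverse_real_of_nat, of 1] by simp
  have c01: "c k \<in> {0..<1}" for k
    by (auto simp: c_def field_simps)
  define opt where "opt k f \<longleftrightarrow> (\<forall>t\<in>states G. f t \<in> cop_playable G t \<and>
    cop_value G (disc_value G (c k)) t (f t)
      = (MAX a\<in>cop_playable G t. cop_value G (disc_value G (c k)) t a))" for k f
  have "\<exists>f. f \<in> PiE (states G) (\<lambda>_. cop_actions G) \<and> opt k f" for k
  proof -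
    have "\<exists>a\<in>cop_playable G t. cop_value G (disc_value G (c k)) t a
        = (MAX a\<in>cop_playable G t. cop_value G (disc_value G (c k)) t a)" if "t \<in> states G" for t
      using that by (intro finite_arg_max_exists finite_cop_playable cop_playable_nonempty)
    then obtain f where "opt k f"
      unfolding opt_def by metis
    \<comment> \<open>Restricting to \<open>states G\<close> places all maximisers in one finite
      function space without changing their values on states.\<close>
    then show ?thesis
      by (intro exI[of _ "restrict f (states G)"]) (auto simp: opt_def cop_playable_def)
  qed
  then obtain f where f: "\<And>k. f k \<in> PiE (states G) (\<lambda>_. cop_actions G)" "\<And>k. opt k (f k)"
    by metis
  have "finite (range f)"
    using f(1) finite_states finite_cop_actions
    by (intro finite_subset[of "range f" "PiE (states G) (\<lambda>_. cop_actions G)"] finite_PiE) auto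
  then obtain k0 where "infinite {k. f k = f k0}"
    using pigeonhole_infinite[of UNIV f] by auto
  \<comment> \<open>Enumerating the infinite fibre increasingly yields a subsequence, along which
    the factors still tend to 1.\<close>
  then obtain r :: "nat \<Rightarrow> nat" where r: "strict_mono r" "\<And>k. f (r k) = f k0"
    using infinite_enumerate by blast
  have "opt (r k) (f k0)" for k
    using f(2)[of "r k"] r(2) by simp
  then show ?thesis
    using LIMSEQ_subseq_LIMSEQ[OF c r(1)] c01
    by (intro exI[of _ "f k0"] exI[of _ "c \<circ> r"]) (auto simp: opt_def)
qed

end

theorem theorem2:
  fixes G :: "('s, 'a) gpcr"
  assumes "gpcr_game G"
  shows "(\<forall>s\<in>states G. (\<lambda>n. w G n s) \<longlonglongrightarrow> w_inf G s)
    \<and> (\<forall>s\<in>states G. w_inf G s =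
          (if s \<in> final G then 1
           else (MAX a\<in>cop_playable G s. cop_value G (w_inf G) s a)))
    \<and> (\<exists>f. (\<forall>s\<in>states G. cop_optimal_from G (memoryless f) s)
          \<and> (\<forall>s\<in>states G - final G.
                is_arg_max (cop_value G (w_inf G) s) (\<lambda>a. a \<in> cop_playable G s) (f s)))"
proof -
  interpret gpcr_game G by fact
  obtain f b where f: "\<And>t. t \<in> states G \<Longrightarrow> f t \<in> cop_playable G t"
    and b: "b \<longlonglongrightarrow> 1" "\<And>k. b k \<in> {0..<1}"
    and max: "\<And>k t. t \<in> states G \<Longrightarrow> cop_value G (disc_value G (b k)) t (f t)
      = (MAX a\<in>cop_playable G t. cop_value G (disc_value G (b k)) t a)"
    using uniformly_optimal_exists by metis
  have lim: "(\<lambda>k. disc_value G (b k) t) \<longlonglongrightarrow> w_inf G t" if "t \<in> states G" for t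
    using b that by (intro disc_value_tendsto_w_inf) (auto simp: less_imp_le)
  have "is_arg_max (cop_value G (w_inf G) t) (\<lambda>a. a \<in> cop_playable G t) (f t)"
    if t: "t \<in> states G" for t
  proof -
    have "cop_value G (w_inf G) t (f t) = (MAX a\<in>cop_playable G t. cop_value G (w_inf G) t a)"
    \<comment> \<open>The action \<open>f t\<close> is the same for all \<open>k\<close>, so its
      maximality for the discounted values survives the passage to the limit.\<close>
    proof (rule LIMSEQ_unique)
      show "(\<lambda>k. cop_value G (disc_value G (b k)) t (f t)) \<longlonglongrightarrow> cop_value G (w_inf G) t (f t)"
        by (intro tendsto_cop_value lim)
      show "(\<lambda>k. cop_value G (disc_value G (b k)) t (f t))
          \<longlonglongrightarrow> (MAX a\<in>cop_playable G t. cop_value G (w_inf G) t a)"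
        unfolding max[OF t] by (intro tendsto_MAX_cop_value t lim)
    qed
    then show ?thesis
      using f[OF t] finite_cop_playable[of t] by (auto simp: is_arg_max_linorder)
  qed
  moreover have "cop_optimal_from G (memoryless f) s" if s: "s \<in> states G" for s
  proof -
    \<comment> \<open>The winning probability does not depend on \<open>k\<close>, so it bounds the
      limit of the discounted values as well.\<close>
    have "w_inf G s \<le> win_prob G (memoryless f) \<rho> s" if "rob_strategy G \<rho>" for \<rho>
      using LIMSEQ_le_const2[OF lim[OF s]] disc_value_le_win_prob[OF b(2) s that f max] by blast
    then have "w_inf G s \<le> guaranteed_prob G (memoryless f) s"
      by (rule le_guaranteed_prob)
    then show ?thesis
      using guaranteed_prob_le_w_inf[OF _ s] memoryless_cop_strategy[OF f]
      by (auto simp: cop_optimal_from_def intro: order_trans)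
  qed
  moreover have "(\<lambda>n. w G n s) \<longlonglongrightarrow> w_inf G s" if "s \<in> states G" for s
    using disc_w_LIMSEQ[of 1 s] that by (simp add: disc_w_1 disc_value_1)
  ultimately show ?thesis
    using w_inf_fixpoint by blast
qed

end
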